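(* Let $\Gamma$ be a simple strongly connected digraph with vertex set $X$, adjacency matrix $A$, diameter $D$, adjacency algebra $\mathcal{A}$ (the algebra generated by $A$), and distance-$i$ matrices $A_0=I,A_1=A,\ldots,A_D$. Then $\Gamma$ is a distance-regular digraph if and only if $A^\top\in\{A_0,A_1,\ldots,A_D\}$ and $\{A_0,A_1,\ldots,A_D\}$ is a basis of $\mathcal{A}$.
   Context: $\partial(x,y)$ is the directed distance; $\Gamma^{\rightarrow}_i(x)=\{z\mid\partial(x,z)=i\}$; $(A_i)_{xy}=1$ iff $\partial(x,y)=i$, else $0$. $\Gamma$ is a distance-regular digraph if there are integers $d^{\rightarrow}_{ij},d^{\leftarrow}_{ij}$ $(0\le i,j\le D)$ such that for every $x\in X$ and every $y\in\Gamma^{\rightarrow}_i(x)$: $|\Gamma^{\rightarrow}_1(y)\cap\Gamma^{\rightarrow}_j(x)|=d^{\rightarrow}_{ij}$ and $|\Gamma^{\leftarrow}_1(y)\cap\Gamma^{\rightarrow}_j(x)|=d^{\leftarrow}_{ij}$, where $\Gamma^{\rightarrow}_1(y)$ (resp. $\Gamma^{\leftarrow}_1(y)$) is the set of out-neighbours (resp. in-neighbours) of $y$. *)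

theory Defs
  imports "HOL-Analysis.Analysis" "Graph_Theory.Shortest_Path" "Graph_Theory.Digraph_Component"
begin

text \<open>
  The directed distance: the least number of arcs on a directed walk. It is meaningful only if
  \<open>y\<close> is reachable from \<open>x\<close>, which strong connectivity guarantees; lemma \<open>ddist_eq_mu\<close> identifies
  it with the shortest-path function of the library for unit arc weights.
\<close>

definition ddist :: "('v, 'e) pre_digraph \<Rightarrow> 'v \<Rightarrow> 'v \<Rightarrow> nat" where
  "ddist G x y = (LEAST n. \<exists>p. pre_digraph.awalk G x p y \<and> length p = n)"

definition digraph_diameter :: "('v, 'e) pre_digraph \<Rightarrow> nat" where
  "digraph_diameter G = Max {ddist G x y | x y. x \<in> verts G \<and> y \<in> verts G}"

definition out_sphere :: "('v, 'e) pre_digraph \<Rightarrow> nat \<Rightarrow> 'v \<Rightarrow> 'v set" where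
  "out_sphere G i x = {z \<in> verts G. ddist G x z = i}"

definition in_sphere :: "('v, 'e) pre_digraph \<Rightarrow> nat \<Rightarrow> 'v \<Rightarrow> 'v set" where
  "in_sphere G i x = {z \<in> verts G. ddist G z x = i}"

definition distance_regular_digraph :: "('v, 'e) pre_digraph \<Rightarrow> bool" where
  "distance_regular_digraph G \<longleftrightarrow>
     (\<exists>d_out d_in :: nat \<Rightarrow> nat \<Rightarrow> int.
        \<forall>i \<le> digraph_diameter G. \<forall>j \<le> digraph_diameter G.
          \<forall>x \<in> verts G. \<forall>y \<in> out_sphere G i x.
            int (card (out_sphere G 1 y \<inter> out_sphere G j x)) = d_out i j \<and>
            int (card (in_sphere G 1 y \<inter> out_sphere G j x)) = d_in i j)"

text \<open>Matrices are indexed by the vertices, so here the vertex set is a whole finite type.\<close>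

definition adjacency_matrix :: "('v::finite, 'e) pre_digraph \<Rightarrow> complex^'v^'v" where
  "adjacency_matrix G = (\<chi> x y. if x \<rightarrow>\<^bsub>G\<^esub> y then 1 else 0)"

definition distance_matrix :: "('v::finite, 'e) pre_digraph \<Rightarrow> nat \<Rightarrow> complex^'v^'v" where
  "distance_matrix G i = (\<chi> x y. if ddist G x y = i then 1 else 0)"

text \<open>
  The library makes \<open>complex^'n^'n\<close> a vector space over the reals only; the linear notions
  below (prefix \<open>cmat\<close>) are those of the complex vector space of square matrices.
\<close>

definition cmat_scale :: "complex \<Rightarrow> complex^'n^'n \<Rightarrow> complex^'n^'n" where
  "cmat_scale c M = (\<chi> i j. c * M $ i $ j)"

global_interpretation cmat: vector_space cmat_scale
  by unfold_locales (simp_all add: cmat_scale_def vec_eq_iff algebra_simps)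

definition matrix_subalgebra :: "(complex^'n^'n) set \<Rightarrow> bool" where
  "matrix_subalgebra B \<longleftrightarrow>
     cmat.subspace B \<and> mat 1 \<in> B \<and> (\<forall>M \<in> B. \<forall>N \<in> B. M ** N \<in> B)"

definition adjacency_algebra :: "('v::finite, 'e) pre_digraph \<Rightarrow> (complex^'v^'v) set" where
  "adjacency_algebra G = matrix_subalgebra hull {adjacency_matrix G}"

definition cmat_basis_of :: "(complex^'n^'n) set \<Rightarrow> (complex^'n^'n) set \<Rightarrow> bool" where
  "cmat_basis_of B V \<longleftrightarrow> cmat.independent B \<and> cmat.span B = V"


lemma matrix_subalgebra_hull: "matrix_subalgebra (matrix_subalgebra hull S)"
  by (rule hull_in)
     (auto simp: matrix_subalgebra_def intro!: cmat.subspace_Inter)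

context wf_digraph
begin

lemma ddist_least:
  assumes "awalk x p y"
  shows "ddist G x y \<le> length p"
  unfolding ddist_def using assms by (intro Least_le) blast

lemma ddist_attained:
  assumes "x \<rightarrow>\<^sup>* y"
  obtains p where "awalk x p y" "length p = ddist G x y"
proof -
  from assms have "\<exists>n p. awalk x p y \<and> length p = n"
    by (auto simp: reachable_awalk)
  then have "\<exists>p. awalk x p y \<and> length p = ddist G x y"
    unfolding ddist_def by (rule LeastI_ex)
  then show thesis using that by blast
qed

lemma ddist_eq_mu:
  assumes "x \<rightarrow>\<^sup>* y"
  shows "ereal (real (ddist G x y)) = \<mu> (\<lambda>_. 1) x y"
proof -
  have cost: "awalk_cost (\<lambda>_. 1) p = real (length p)" for p :: "'b list"
    by (induction p) auto
  obtain p where p: "awalk x p y" "length p = ddist G x y"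
    using ddist_attained[OF assms] .
  show ?thesis
    unfolding \<mu>_def cost
    by (rule antisym, rule INF_greatest, use ddist_least in force,
        rule INF_lower2[of p], use p in auto)
qed

lemma ddist_eq_0_iff:
  assumes "x \<rightarrow>\<^sup>* y"
  shows "ddist G x y = 0 \<longleftrightarrow> x = y"
proof
  assume "ddist G x y = 0"
  with ddist_attained[OF assms] obtain p where "awalk x p y" "p = []" by auto
  then show "x = y" by (simp add: awalk_Nil_iff)
next
  assume "x = y"
  with assms have "awalk x [] y"
    by (auto simp: awalk_Nil_iff elim: reachable_in_vertsE)
  from ddist_least[OF this] show "ddist G x y = 0" by simp
qed

end

lemma (in digraph) ddist_eq_1_iff:
  assumes "x \<rightarrow>\<^sup>* y"
  shows "ddist G x y = 1 \<longleftrightarrow> x \<rightarrow> y"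
proof
  assume "ddist G x y = 1"
  with ddist_attained[OF assms] obtain p where p: "awalk x p y" "length p = 1" by auto
  then obtain e where "p = [e]" by (auto simp: length_Suc_conv)
  with p show "x \<rightarrow> y" by (auto simp: awalk_Cons_iff awalk_Nil_iff arcs_ends_conv)
next
  assume xy: "x \<rightarrow> y"
  then obtain e where "e \<in> arcs G" "tail G e = x" "head G e = y" by auto
  then have "awalk x [e] y" by (auto simp: awalk_Cons_iff awalk_Nil_iff)
  from ddist_least[OF this] have "ddist G x y \<le> 1" by simp
  moreover have "ddist G x y \<noteq> 0"
    using ddist_eq_0_iff[OF assms] xy adj_not_same by auto
  ultimately show "ddist G x y = 1" by simp
qed

lemma distance_matrix_0:
  assumes "wf_digraph G" "strongly_connected G" "verts G = UNIV"
  shows "distance_matrix G 0 = mat 1"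
  using assms wf_digraph.ddist_eq_0_iff[OF assms(1)]
  by (auto simp: distance_matrix_def mat_def vec_eq_iff strongly_connected_def)

lemma distance_matrix_1:
  assumes "digraph G" "strongly_connected G" "verts G = UNIV"
  shows "distance_matrix G 1 = adjacency_matrix G"
  using assms digraph.ddist_eq_1_iff[OF assms(1)]
  by (auto simp: distance_matrix_def adjacency_matrix_def vec_eq_iff strongly_connected_def)

end

theory Submission
  imports Defs
begin

text \<open>
  The span of the distance matrices consists of the matrices whose entries depend only on the
  distance, and \<open>(A\<^sub>j A)\<^sub>x\<^sub>y\<close>, \<open>(A\<^sub>j A\<^sup>T)\<^sub>x\<^sub>y\<close> are the two neighbour counts in the definition of
  distance-regularity. So \<open>\<Gamma>\<close> is distance-regular iff this span is closed under right
  multiplication by \<open>A\<close> and \<open>A\<^sup>T\<close>. In that case the span is the adjacency algebra, because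
  \<open>A\<^sub>j A\<close> is a combination of \<open>A\<^sub>0, \<dots>, A\<^sub>j\<^sub>+\<^sub>1\<close> in which \<open>A\<^sub>j\<^sub>+\<^sub>1\<close> has a nonzero coefficient, and
  it is closed under transposition. If \<open>x \<rightarrow> y\<close> is an arc and \<open>i = \<partial>(y,x)\<close>, then
  the entries of \<open>A\<^sub>i\<^sup>T\<close> are constant on arcs and those of \<open>A\<^sup>T\<close> are constant on pairs at distance
  \<open>i\<close>, which forces \<open>A\<^sup>T = A\<^sub>i\<close>.
\<close>

lemma cmat_scale_nth [simp]: "cmat_scale c M $ i $ j = c * M $ i $ j"
  by (simp add: cmat_scale_def)

lemma matrix_mult_nth: "(M ** N) $ i $ j = (\<Sum>k\<in>UNIV. M $ i $ k * N $ k $ j)"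
  by (simp add: matrix_matrix_mult_def)

lemma matrix_mult_add_left: "(M + N) ** P = M ** P + (N ** P :: complex^'n^'n)"
  by (simp add: vec_eq_iff matrix_mult_nth sum.distrib algebra_simps)

lemma cmat_scale_mult_left: "cmat_scale c M ** N = cmat_scale c (M ** N)"
  by (simp add: vec_eq_iff matrix_mult_nth sum_distrib_left mult.assoc)

lemma cmat_scale_mult_right: "M ** cmat_scale c N = cmat_scale c (M ** N)"
  by (simp add: vec_eq_iff matrix_mult_nth sum_distrib_left algebra_simps)

lemma transpose_nth [simp]: "transpose M $ i $ j = M $ j $ i"
  by (simp add: transpose_def)

lemma matrix_subalgebra_right_stabilizer:
  assumes "cmat.subspace K"
  shows "matrix_subalgebra {N. \<forall>M\<in>K. M ** N \<in> K}"
  using assms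
  by (auto simp: matrix_subalgebra_def cmat.subspace_def matrix_add_ldistrib
      cmat_scale_mult_right matrix_mul_assoc)

lemma matrix_subalgebra_transpose:
  fixes B :: "(complex^'n^'n) set"
  assumes "matrix_subalgebra B"
  shows "matrix_subalgebra {M. transpose M \<in> B}"
proof -
  have [simp]: "transpose (0 :: complex^'n^'n) = 0"
    "transpose (M + N) = transpose M + transpose N"
    "transpose (cmat_scale c M) = cmat_scale c (transpose M)" for c and M N :: "complex^'n^'n"
    by (simp_all add: vec_eq_iff)
  show ?thesis
    using assms
    by (auto simp: matrix_subalgebra_def cmat.subspace_def matrix_transpose_mul)
qed

definition distance_class_matrices :: "('v::finite, 'e) pre_digraph \<Rightarrow> (complex^'v^'v) set" where
  "distance_class_matrices G = {M. \<exists>f. \<forall>x y. M $ x $ y = f (ddist G x y)}"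

lemma distance_matrix_nth:
  "distance_matrix G i $ x $ y = (if ddist G x y = i then 1 else 0)"
  by (simp add: distance_matrix_def)

lemma distance_class_matrices_subspace:
  fixes G :: "('v::finite, 'e) pre_digraph"
  shows "cmat.subspace (distance_class_matrices G)"
  unfolding cmat.subspace_def distance_class_matrices_def
proof (intro conjI ballI allI)
  show "0 \<in> {M. \<exists>f. \<forall>x y. M $ x $ y = f (ddist G x y)}"
    by (auto intro: exI[of _ "\<lambda>_. 0"])
next
  fix M N :: "complex^'v^'v"
  assume "M \<in> {M. \<exists>f. \<forall>x y. M $ x $ y = f (ddist G x y)}"
    "N \<in> {M. \<exists>f. \<forall>x y. M $ x $ y = f (ddist G x y)}"
  then obtain f g where "\<forall>x y. M $ x $ y = f (ddist G x y)" "\<forall>x y. N $ x $ y = g (ddist G x y)"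
    by blast
  then show "M + N \<in> {M. \<exists>f. \<forall>x y. M $ x $ y = f (ddist G x y)}"
    by (auto intro!: exI[of _ "\<lambda>i. f i + g i"])
next
  fix c and M :: "complex^'v^'v"
  assume "M \<in> {M. \<exists>f. \<forall>x y. M $ x $ y = f (ddist G x y)}"
  then obtain f where "\<forall>x y. M $ x $ y = f (ddist G x y)"
    by blast
  then show "cmat_scale c M \<in> {M. \<exists>f. \<forall>x y. M $ x $ y = f (ddist G x y)}"
    by (auto intro!: exI[of _ "\<lambda>i. c * f i"])
qed

lemma distance_matrix_in_distance_class_matrices:
  "distance_matrix G i \<in> distance_class_matrices G"
  unfolding distance_class_matrices_def
  by (auto simp: distance_matrix_nth intro!: exI[of _ "\<lambda>k. if k = i then 1 else 0"])

lemma distance_class_matrices_const: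
  assumes "M \<in> distance_class_matrices G" "ddist G x y = ddist G u v"
  shows "M $ x $ y = M $ u $ v"
  using assms by (auto simp: distance_class_matrices_def)

locale strongly_connected_digraph = digraph G for G :: "('v::finite, 'e) pre_digraph" (structure) +
  assumes strongly_connected: "strongly_connected G"
    and verts_UNIV: "verts G = UNIV"
begin

lemma reach: "x \<rightarrow>\<^sup>* y"
  using strongly_connected by (simp add: strongly_connected_def verts_UNIV)

lemma ddist_le_diameter: "ddist G x y \<le> digraph_diameter G"
proof -
  have "{ddist G x y |x y. x \<in> verts G \<and> y \<in> verts G} = range (\<lambda>(x, y). ddist G x y)"
    by (auto simp: verts_UNIV)
  then show ?thesis
    unfolding digraph_diameter_def by (auto intro!: Max_ge)
qed

lemma ddist_Suc_le:
  assumes "z \<rightarrow> y"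
  shows "ddist G x y \<le> Suc (ddist G x z)"
proof -
  obtain p where p: "awalk x p z" "length p = ddist G x z"
    using ddist_attained[OF reach] .
  from assms obtain e where "e \<in> arcs G" "tail G e = z" "head G e = y" by auto
  then have "awalk z [e] y" by (auto simp: awalk_Cons_iff awalk_Nil_iff)
  with p have "awalk x (p @ [e]) y" by (auto intro: awalk_appendI)
  from ddist_least[OF this] p show ?thesis by simp
qed

lemma ddist_Suc_predecessor:
  assumes "ddist G x y = Suc n"
  obtains z where "ddist G x z = n" "z \<rightarrow> y"
proof -
  obtain p where p: "awalk x p y" "length p = Suc n"
    using ddist_attained[OF reach] assms by metis
  then obtain q e where q: "p = q @ [e]" "length q = n"
    by (metis length_Suc_conv_rev)
  with p obtain z where z: "awalk x q z" "awalk z [e] y"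
    by (auto simp: awalk_append_iff)
  then have zy: "z \<rightarrow> y"
    by (auto simp: awalk_Cons_iff awalk_Nil_iff arcs_ends_conv)
  from ddist_least[OF z(1)] ddist_Suc_le[OF zy, of x] assms q have "ddist G x z = n" by simp
  then show thesis using zy that by blast
qed

lemma ddist_attains:
  assumes "i \<le> digraph_diameter G"
  obtains x y where "ddist G x y = i"
proof -
  have "\<exists>x y. ddist G x y = i"
    using assms
  proof (induction rule: inc_induct)
    case base
    have eq: "{ddist G x y |x y. x \<in> verts G \<and> y \<in> verts G} = range (\<lambda>(x, y). ddist G x y)"
      by (auto simp: verts_UNIV)
    have "digraph_diameter G \<in> {ddist G x y |x y. x \<in> verts G \<and> y \<in> verts G}"
      unfolding digraph_diameter_def eq by (intro Max_in) auto
    then obtain x y where "digraph_diameter G = ddist G x y" by auto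
    then show ?case by metis
  next
    case (step n)
    then show ?case by (metis ddist_Suc_predecessor)
  qed
  then show thesis using that by blast
qed

lemma distance_matrices_independent:
  "cmat.independent (distance_matrix G ` {0..digraph_diameter G})"
proof
  let ?B = "distance_matrix G ` {0..digraph_diameter G}"
  assume "cmat.dependent ?B"
  then obtain i where i: "i \<le> digraph_diameter G"
    "distance_matrix G i \<in> cmat.span (?B - {distance_matrix G i})"
    by (auto simp: cmat.dependent_def)
  obtain x y where xy: "ddist G x y = i" using ddist_attains[OF i(1)] .
  have "cmat.span (?B - {distance_matrix G i}) \<subseteq> {M. M $ x $ y = 0}"
    by (rule cmat.span_minimal) (auto simp: distance_matrix_nth xy cmat.subspace_def)
  with i(2) show False by (auto simp: distance_matrix_nth xy)
qed

lemma distance_matrices_span: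
  "cmat.span (distance_matrix G ` {0..digraph_diameter G}) = distance_class_matrices G"
proof
  show "cmat.span (distance_matrix G ` {0..digraph_diameter G}) \<subseteq> distance_class_matrices G"
    by (rule cmat.span_minimal)
      (auto intro: distance_class_matrices_subspace distance_matrix_in_distance_class_matrices)
next
  show "distance_class_matrices G \<subseteq> cmat.span (distance_matrix G ` {0..digraph_diameter G})"
  proof
    fix M assume "M \<in> distance_class_matrices G"
    then obtain f where f: "\<And>x y. M $ x $ y = f (ddist G x y)"
      by (auto simp: distance_class_matrices_def)
    have "M = (\<Sum>i\<in>{0..digraph_diameter G}. cmat_scale (f i) (distance_matrix G i))"
      by (simp add: vec_eq_iff f distance_matrix_nth if_distrib[of "\<lambda>t. _ * t"] ddist_le_diameter
          cong: if_cong)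
    also have "\<dots> \<in> cmat.span (distance_matrix G ` {0..digraph_diameter G})"
      by (intro cmat.span_sum cmat.span_scale cmat.span_base) auto
    finally show "M \<in> cmat.span (distance_matrix G ` {0..digraph_diameter G})" .
  qed
qed

lemma adjacency_matrix_nth: "adjacency_matrix G $ x $ y = (if x \<rightarrow> y then 1 else 0)"
  by (simp add: adjacency_matrix_def)

lemma distance_mult_adjacency_nth:
  "(distance_matrix G j ** adjacency_matrix G) $ x $ y
    = of_nat (card (in_sphere G 1 y \<inter> out_sphere G j x))"
proof -
  have eq: "in_sphere G 1 y \<inter> out_sphere G j x = {z. ddist G x z = j \<and> (z \<rightarrow> y)}"
    using ddist_eq_1_iff[OF reach] by (auto simp: in_sphere_def out_sphere_def verts_UNIV)
  have "(distance_matrix G j ** adjacency_matrix G) $ x $ y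
      = (\<Sum>z\<in>UNIV. if ddist G x z = j \<and> (z \<rightarrow> y) then 1 else 0)"
    unfolding matrix_mult_nth
    by (intro sum.cong) (auto simp: distance_matrix_nth adjacency_matrix_nth)
  also have "\<dots> = of_nat (card {z. ddist G x z = j \<and> (z \<rightarrow> y)})"
    by (subst sum.If_cases) auto
  finally show ?thesis unfolding eq .
qed

lemma distance_mult_transpose_adjacency_nth:
  "(distance_matrix G j ** transpose (adjacency_matrix G)) $ x $ y
    = of_nat (card (out_sphere G 1 y \<inter> out_sphere G j x))"
proof -
  have eq: "out_sphere G 1 y \<inter> out_sphere G j x = {z. ddist G x z = j \<and> (y \<rightarrow> z)}"
    using ddist_eq_1_iff[OF reach] by (auto simp: out_sphere_def verts_UNIV)
  have "(distance_matrix G j ** transpose (adjacency_matrix G)) $ x $ y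
      = (\<Sum>z\<in>UNIV. if ddist G x z = j \<and> (y \<rightarrow> z) then 1 else 0)"
    unfolding matrix_mult_nth
    by (intro sum.cong) (auto simp: distance_matrix_nth adjacency_matrix_nth)
  also have "\<dots> = of_nat (card {z. ddist G x z = j \<and> (y \<rightarrow> z)})"
    by (subst sum.If_cases) auto
  finally show ?thesis unfolding eq .
qed

lemma distance_regular_iff:
  "distance_regular_digraph G \<longleftrightarrow> (\<forall>j \<le> digraph_diameter G.
     distance_matrix G j ** adjacency_matrix G \<in> distance_class_matrices G \<and>
     distance_matrix G j ** transpose (adjacency_matrix G) \<in> distance_class_matrices G)"
  (is "?L \<longleftrightarrow> ?R")
proof
  assume ?L
  then obtain d_out d_in :: "nat \<Rightarrow> nat \<Rightarrow> int" where
    "\<forall>i \<le> digraph_diameter G. \<forall>j \<le> digraph_diameter G. \<forall>x \<in> verts G. \<forall>y \<in> out_sphere G i x.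
      int (card (out_sphere G 1 y \<inter> out_sphere G j x)) = d_out i j \<and>
      int (card (in_sphere G 1 y \<inter> out_sphere G j x)) = d_in i j"
    unfolding distance_regular_digraph_def by blast
  moreover have "y \<in> out_sphere G (ddist G x y) x" for x y
    by (simp add: out_sphere_def verts_UNIV)
  ultimately have d: "int (card (out_sphere G 1 y \<inter> out_sphere G j x)) = d_out (ddist G x y) j \<and>
      int (card (in_sphere G 1 y \<inter> out_sphere G j x)) = d_in (ddist G x y) j"
    if "j \<le> digraph_diameter G" for x y j
    using that ddist_le_diameter verts_UNIV by (metis UNIV_I)
  show ?R
    unfolding distance_class_matrices_def mem_Collect_eq
      distance_mult_adjacency_nth distance_mult_transpose_adjacency_nth
  proof (intro allI impI conjI exI)
    fix j x y assume j: "j \<le> digraph_diameter G"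
    show "of_nat (card (in_sphere G 1 y \<inter> out_sphere G j x))
        = (of_int (d_in (ddist G x y) j) :: complex)"
      using d[OF j, of y x] by (metis of_int_of_nat_eq)
    show "of_nat (card (out_sphere G 1 y \<inter> out_sphere G j x))
        = (of_int (d_out (ddist G x y) j) :: complex)"
      using d[OF j, of y x] by (metis of_int_of_nat_eq)
  qed
next
  assume R: ?R
  then have "\<forall>j. \<exists>f. j \<le> digraph_diameter G \<longrightarrow>
      (\<forall>x y. (of_nat (card (in_sphere G 1 y \<inter> out_sphere G j x)) :: complex) = f (ddist G x y))"
    unfolding distance_class_matrices_def mem_Collect_eq distance_mult_adjacency_nth by blast
  then obtain f where f: "\<And>j x y. j \<le> digraph_diameter G \<Longrightarrow>
      (of_nat (card (in_sphere G 1 y \<inter> out_sphere G j x)) :: complex) = f j (ddist G x y)"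
    by metis
  from R have "\<forall>j. \<exists>g. j \<le> digraph_diameter G \<longrightarrow>
      (\<forall>x y. (of_nat (card (out_sphere G 1 y \<inter> out_sphere G j x)) :: complex) = g (ddist G x y))"
    unfolding distance_class_matrices_def mem_Collect_eq distance_mult_transpose_adjacency_nth
    by blast
  then obtain g where g: "\<And>j x y. j \<le> digraph_diameter G \<Longrightarrow>
      (of_nat (card (out_sphere G 1 y \<inter> out_sphere G j x)) :: complex) = g j (ddist G x y)"
    by metis
  show ?L
    unfolding distance_regular_digraph_def
  proof (intro exI allI impI ballI)
    fix i j x y
    assume j: "j \<le> digraph_diameter G" and "y \<in> out_sphere G i x"
    then have i: "ddist G x y = i" by (simp add: out_sphere_def)
    show "int (card (out_sphere G 1 y \<inter> out_sphere G j x)) = \<lfloor>Re (g j i)\<rfloor> \<and>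
        int (card (in_sphere G 1 y \<inter> out_sphere G j x)) = \<lfloor>Re (f j i)\<rfloor>"
      unfolding i[symmetric] f[OF j, symmetric] g[OF j, symmetric] by simp
  qed
qed

lemma distance_matrix_in_subalgebra:
  assumes B: "matrix_subalgebra B" "adjacency_matrix G \<in> B"
    and mult: "\<And>j. j \<le> digraph_diameter G \<Longrightarrow>
      distance_matrix G j ** adjacency_matrix G \<in> distance_class_matrices G"
    and "i \<le> digraph_diameter G"
  shows "distance_matrix G i \<in> B"
  using assms(4)
proof (induction i rule: less_induct)
  case (less i)
  show ?case
  proof (cases i)
    case 0
    have "distance_matrix G 0 = mat 1"
      using distance_matrix_0[OF wf_digraph_axioms strongly_connected verts_UNIV] .
    with 0 B(1) show ?thesis by (simp add: matrix_subalgebra_def)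
  next
    case (Suc j)
    define P where "P = distance_matrix G j ** adjacency_matrix G"
    have "P \<in> distance_class_matrices G" using mult[of j] less.prems Suc by (simp add: P_def)
    then obtain f where f: "\<And>x y. P $ x $ y = f (ddist G x y)"
      by (auto simp: distance_class_matrices_def)
    have "P \<in> B"
      using less.IH[of j] less.prems Suc B by (auto simp: P_def matrix_subalgebra_def)
    have P_eq_0_iff: "P $ x $ y = 0 \<longleftrightarrow> (\<forall>z. ddist G x z = j \<longrightarrow> \<not> z \<rightarrow> y)" for x y
      using ddist_eq_1_iff[OF reach] unfolding P_def distance_mult_adjacency_nth
      by (auto simp: in_sphere_def out_sphere_def verts_UNIV)
    have nz: "f i \<noteq> 0"
    proof -
      obtain x y where "ddist G x y = i" using ddist_attains[OF less.prems] .
      then show ?thesis using ddist_Suc_predecessor[of x y j] P_eq_0_iff[of x y] f Suc by metis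
    qed
    have z: "f (ddist G x y) = 0" if "ddist G x y > i" for x y
      using that P_eq_0_iff[of x y] ddist_Suc_le[of _ y x] Suc unfolding f by fastforce
    define Q where "Q = cmat_scale (1 / f i)
      (P - (\<Sum>k<i. cmat_scale (f k) (distance_matrix G k)))"
    have "distance_matrix G i $ x $ y = Q $ x $ y" for x y
      using nz z[of x y]
      by (cases "ddist G x y" i rule: linorder_cases)
        (auto simp: Q_def f distance_matrix_nth if_distrib[of "\<lambda>t. _ * t"] cong: if_cong)
    then have "distance_matrix G i = Q" by (simp add: vec_eq_iff)
    also have "Q \<in> B"
      unfolding Q_def using B(1) \<open>P \<in> B\<close> less
      by (auto simp: matrix_subalgebra_def
          intro!: cmat.subspace_scale cmat.subspace_diff cmat.subspace_sum)
    finally show ?thesis .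
  qed
qed

theorem distance_regular_iff_basis:
  assumes "digraph_diameter G \<ge> 1"
  shows "distance_regular_digraph G \<longleftrightarrow>
    transpose (adjacency_matrix G) \<in> distance_matrix G ` {0..digraph_diameter G} \<and>
    cmat_basis_of (distance_matrix G ` {0..digraph_diameter G}) (adjacency_algebra G)"
    (is "_ \<longleftrightarrow> ?At \<in> ?B \<and> _")
proof -
  let ?A = "adjacency_matrix G" and ?K = "distance_class_matrices G"
    and ?\<A> = "adjacency_algebra G"
  have alg: "matrix_subalgebra ?\<A>"
    unfolding adjacency_algebra_def by (rule matrix_subalgebra_hull)
  have A_in: "?A \<in> ?\<A>"
    unfolding adjacency_algebra_def by (simp add: hull_inc)
  have alg_least: "?\<A> \<subseteq> S" if "matrix_subalgebra S" "?A \<in> S" for S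
    unfolding adjacency_algebra_def using that by (intro hull_minimal) auto
  have I_eq: "distance_matrix G 0 = mat 1"
    using distance_matrix_0[OF wf_digraph_axioms strongly_connected verts_UNIV] .
  have basis_iff: "cmat_basis_of ?B ?\<A> \<longleftrightarrow> ?K = ?\<A>"
    using distance_matrices_independent distance_matrices_span by (simp add: cmat_basis_of_def)
  show ?thesis
    unfolding basis_iff
  proof
    assume drd: "distance_regular_digraph G"
    have KA: "M ** N \<in> ?K" if "M \<in> ?K" "N = ?A" for M N
    proof -
      have "?K \<subseteq> {M. M ** ?A \<in> ?K}"
        unfolding distance_matrices_span[symmetric]
      proof (rule cmat.span_minimal)
        show "cmat.subspace {M. M ** ?A \<in> cmat.span ?B}"
          using cmat.subspace_span[of ?B]
          by (auto simp: cmat.subspace_def matrix_mult_add_left cmat_scale_mult_left)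
        show "?B \<subseteq> {M. M ** ?A \<in> cmat.span ?B}"
          unfolding distance_matrices_span using drd distance_regular_iff by auto
      qed
      with that show ?thesis by blast
    qed
    have "?\<A> \<subseteq> {N. \<forall>M\<in>?K. M ** N \<in> ?K}"
      by (rule alg_least)
        (auto intro: matrix_subalgebra_right_stabilizer distance_class_matrices_subspace KA)
    moreover have "mat 1 \<in> ?K"
      using distance_matrix_in_distance_class_matrices[of G 0] by (simp add: I_eq)
    ultimately have "?\<A> \<subseteq> ?K"
      by (metis (no_types, lifting) matrix_mul_lid mem_Collect_eq subset_iff)
    have dist_in: "distance_matrix G i \<in> ?\<A>" if "i \<le> digraph_diameter G" for i
      using drd that distance_regular_iff by (intro distance_matrix_in_subalgebra alg A_in) auto
    have "?K \<subseteq> ?\<A>"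
      unfolding distance_matrices_span[symmetric]
      by (rule cmat.span_minimal) (use dist_in alg in \<open>auto simp: matrix_subalgebra_def\<close>)
    with \<open>?\<A> \<subseteq> ?K\<close> have K_eq: "?K = ?\<A>" by blast
    have At_K: "?At \<in> ?K"
      using drd distance_regular_iff I_eq by (metis le0 matrix_mul_lid)
    have "?\<A> \<subseteq> {M. transpose M \<in> ?\<A>}"
      by (rule alg_least) (use matrix_subalgebra_transpose[OF alg] At_K K_eq in auto)
    then have distT_K: "transpose (distance_matrix G i) \<in> ?K" if "i \<le> digraph_diameter G" for i
      using dist_in[OF that] K_eq by auto
    obtain x y where xy: "ddist G x y = 1"
      using ddist_attains[OF assms] .
    define i where "i = ddist G y x"
    have i_le: "i \<le> digraph_diameter G" unfolding i_def by (rule ddist_le_diameter)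
    have "?At $ u $ v = distance_matrix G i $ u $ v" for u v
    proof (cases "ddist G u v = i")
      case True
      then have "?At $ u $ v = ?At $ y $ x"
        by (intro distance_class_matrices_const[OF At_K]) (simp add: i_def)
      with True xy show ?thesis
        using ddist_eq_1_iff[OF reach] by (simp add: adjacency_matrix_nth distance_matrix_nth)
    next
      case False
      have "\<not> v \<rightarrow> u"
      proof
        assume "v \<rightarrow> u"
        then have "ddist G v u = ddist G x y"
          using ddist_eq_1_iff[OF reach] xy by metis
        from distance_class_matrices_const[OF distT_K[OF i_le] this] False show False
          by (simp add: distance_matrix_nth i_def)
      qed
      with False show ?thesis by (simp add: adjacency_matrix_nth distance_matrix_nth)
    qed
    then have "?At = distance_matrix G i" by (simp add: vec_eq_iff)
    with i_le K_eq show "?At \<in> ?B \<and> ?K = ?\<A>" by auto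
  next
    assume R: "?At \<in> ?B \<and> ?K = ?\<A>"
    then have dist_in: "distance_matrix G j \<in> ?\<A>" for j
      using distance_matrix_in_distance_class_matrices by metis
    have "?At \<in> ?\<A>"
      using R dist_in by auto
    moreover have "M ** N \<in> ?\<A>" if "M \<in> ?\<A>" "N \<in> ?\<A>" for M N
      using alg that by (simp add: matrix_subalgebra_def)
    ultimately show "distance_regular_digraph G"
      using R A_in dist_in by (metis distance_regular_iff)
  qed
qed

end

theorem theorem6p3:
  fixes G :: "('v::finite, 'e) pre_digraph"
  assumes "digraph G"
    and "strongly_connected G"
    and "verts G = UNIV"
    and "digraph_diameter G \<ge> 1"
  shows "distance_regular_digraph G \<longleftrightarrow>
    transpose (adjacency_matrix G) \<in> distance_matrix G ` {0..digraph_diameter G} \<and>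
    cmat_basis_of (distance_matrix G ` {0..digraph_diameter G}) (adjacency_algebra G)"
proof -
  interpret strongly_connected_digraph G
    using assms by (simp add: strongly_connected_digraph_def strongly_connected_digraph_axioms_def)
  show ?thesis using assms(4) by (rule distance_regular_iff_basis)
qed

end
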